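(* Let $S$ and $R$ be rings and let $f:S\rightarrow R$ be a (not necessarily unitary) ring homomorphism with $f[S]\subseteq Z(R)$. Then $f$ satisfies GD if and only if for every nonempty chain $\mathcal D\subseteq\mathrm{Spec}(S)$ and for every nonempty maximal $\mathcal D$-chain $\mathcal C\subseteq\mathrm{Spec}(R)$ the following holds: for every $P\in\mathcal D$ there exists $Q\in\mathcal C$ such that $f^{-1}[Q]\subseteq P$.
   Context: Rings are nontrivial, associative, with identity, not necessarily commutative; homomorphisms need not send $1$ to $1$. $Z(R)$ is the center of $R$. $\mathrm{Spec}$ denotes the set of prime (two-sided, proper) ideals: $P$ is prime if $aRb\subseteq P$ implies $a\in P$ or $b\in P$. $\subset$ means proper inclusion. All chains are with respect to containment. An ideal $Q$ of $R$ lies over an ideal $P$ of $S$ if $f^{-1}[Q]=P$. (For $Q\in\mathrm{Spec}(R)$, $f^{-1}[Q]$ is either a prime ideal of $S$ or equal to $S$.) GD: for any $P_1\subset P_2$ in $\mathrm{Spec}(S)$ and every $Q_2\in\mathrm{Spec}(R)$ lying over $P_2$, there is $Q_1\subset Q_2$ in $\mathrm{Spec}(R)$ lying over $P_1$. For a chain $\mathcal D\subseteq\mathrm{Spec}(S)$, a $\mathcal D$-chain is a chain $\mathcal C\subseteq\mathrm{Spec}(R)$ with $f^{-1}[Q]\in\mathcal D$ for every $Q\in\mathcal C$. A maximal $\mathcal D$-chain is a $\mathcal D$-chain that is maximal, with respect to containment, among $\mathcal D$-chains. *)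

theory Defs
  imports "HOL-Algebra.Ideal"
begin

text \<open>Ring homomorphisms here need not preserve the identity, so \<^const>\<open>ring_hom\<close>, which
  requires this, is not used; \<^const>\<open>hom\<close> only requires compatibility with the operation.\<close>

definition rng_hom :: "('a, 'm) ring_scheme \<Rightarrow> ('b, 'n) ring_scheme \<Rightarrow> ('a \<Rightarrow> 'b) set" where
  "rng_hom S R = hom S R \<inter> hom (add_monoid S) (add_monoid R)"

definition ring_center :: "('a, 'm) ring_scheme \<Rightarrow> 'a set" where
  "ring_center R = {z \<in> carrier R. \<forall>r \<in> carrier R. z \<otimes>\<^bsub>R\<^esub> r = r \<otimes>\<^bsub>R\<^esub> z}"

text \<open>The locale \<^locale>\<open>primeideal\<close> is restricted to commutative rings; the following is the
  noncommutative notion, with \<open>a R b \<subseteq> P\<close> in place of \<open>a b \<in> P\<close>.\<close>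

definition nc_prime_ideal :: "'a set \<Rightarrow> ('a, 'm) ring_scheme \<Rightarrow> bool" where
  "nc_prime_ideal P R \<longleftrightarrow> ideal P R \<and> P \<noteq> carrier R \<and>
     (\<forall>a \<in> carrier R. \<forall>b \<in> carrier R.
        {a \<otimes>\<^bsub>R\<^esub> r \<otimes>\<^bsub>R\<^esub> b | r. r \<in> carrier R} \<subseteq> P \<longrightarrow> a \<in> P \<or> b \<in> P)"

definition nc_Spec :: "('a, 'm) ring_scheme \<Rightarrow> 'a set set" where
  "nc_Spec R = {P. nc_prime_ideal P R}"

text \<open>Only the values of \<open>f\<close> on \<open>carrier S\<close> matter, so preimages are cut down to the carrier.\<close>

definition preimage :: "('a, 'm) ring_scheme \<Rightarrow> ('a \<Rightarrow> 'b) \<Rightarrow> 'b set \<Rightarrow> 'a set" where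
  "preimage S f Q = f -` Q \<inter> carrier S"

definition lies_over :: "('a, 'm) ring_scheme \<Rightarrow> ('a \<Rightarrow> 'b) \<Rightarrow> 'b set \<Rightarrow> 'a set \<Rightarrow> bool" where
  "lies_over S f Q P \<longleftrightarrow> preimage S f Q = P"

definition GD :: "('a, 'm) ring_scheme \<Rightarrow> ('b, 'n) ring_scheme \<Rightarrow> ('a \<Rightarrow> 'b) \<Rightarrow> bool" where
  "GD S R f \<longleftrightarrow>
     (\<forall>P1 \<in> nc_Spec S. \<forall>P2 \<in> nc_Spec S. P1 \<subset> P2 \<longrightarrow>
        (\<forall>Q2 \<in> nc_Spec R. lies_over S f Q2 P2 \<longrightarrow>
           (\<exists>Q1 \<in> nc_Spec R. Q1 \<subset> Q2 \<and> lies_over S f Q1 P1)))"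

definition D_chain ::
  "('a, 'm) ring_scheme \<Rightarrow> ('b, 'n) ring_scheme \<Rightarrow> ('a \<Rightarrow> 'b) \<Rightarrow> 'a set set \<Rightarrow> 'b set set \<Rightarrow> bool" where
  "D_chain S R f D C \<longleftrightarrow> subset.chain (nc_Spec R) C \<and> (\<forall>Q \<in> C. preimage S f Q \<in> D)"

definition maximal_D_chain ::
  "('a, 'm) ring_scheme \<Rightarrow> ('b, 'n) ring_scheme \<Rightarrow> ('a \<Rightarrow> 'b) \<Rightarrow> 'a set set \<Rightarrow> 'b set set \<Rightarrow> bool" where
  "maximal_D_chain S R f D C \<longleftrightarrow>
     D_chain S R f D C \<and> \<not> (\<exists>C'. D_chain S R f D C' \<and> C \<subset> C')"

end

theory Submission
  imports Defs
begin

text \<open>If \<open>\<C>\<close> is a nonempty maximal \<open>\<D>\<close>-chain all of whose members contract to primes strictly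
  above \<open>P \<in> \<D>\<close>, then \<open>\<Inter>\<C>\<close> is prime and contracts to a prime \<open>\<supseteq> P\<close>, so either \<open>\<Inter>\<C>\<close> itself or,
  by going down, some prime below it lies over \<open>P\<close>; it could be added to \<open>\<C>\<close>. Conversely, to go
  down from \<open>Q\<^sub>2\<close> over \<open>P\<^sub>2\<close> to \<open>P\<^sub>1\<close>, extend \<open>{Q\<^sub>2}\<close> to a maximal \<open>{P\<^sub>1, P\<^sub>2}\<close>-chain.\<close>

lemma nc_SpecD:
  assumes "P \<in> nc_Spec R"
  shows "ideal P R" "P \<noteq> carrier R" "P \<subseteq> carrier R"
    "\<lbrakk>a \<in> carrier R; b \<in> carrier R; \<And>r. r \<in> carrier R \<Longrightarrow> a \<otimes>\<^bsub>R\<^esub> r \<otimes>\<^bsub>R\<^esub> b \<in> P\<rbrakk>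
      \<Longrightarrow> a \<in> P \<or> b \<in> P"
proof -
  have P: "nc_prime_ideal P R" using assms by (simp add: nc_Spec_def)
  then show "ideal P R" "P \<noteq> carrier R" by (simp_all add: nc_prime_ideal_def)
  then show "P \<subseteq> carrier R" by (meson additive_subgroup.a_subset ideal_def)
  show "a \<in> P \<or> b \<in> P" if "a \<in> carrier R" "b \<in> carrier R"
    "\<And>r. r \<in> carrier R \<Longrightarrow> a \<otimes>\<^bsub>R\<^esub> r \<otimes>\<^bsub>R\<^esub> b \<in> P"
  proof -
    have "{a \<otimes>\<^bsub>R\<^esub> r \<otimes>\<^bsub>R\<^esub> b | r. r \<in> carrier R} \<subseteq> P" using that(3) by blast
    then show ?thesis using P that(1,2) unfolding nc_prime_ideal_def by blast
  qed
qed

text \<open>If \<open>a\<close> and \<open>b\<close> each avoid some member of the chain, the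
  smaller of these two members avoids both, against its primeness. Nonemptiness of \<open>C\<close>
  matters, as an empty intersection would be \<open>UNIV\<close>.\<close>

lemma nc_Spec_Inter_chain:
  assumes "ring R" and chain: "subset.chain (nc_Spec R) C" and "C \<noteq> {}"
  shows "\<Inter>C \<in> nc_Spec R"
proof -
  have spec: "Q \<in> nc_Spec R" if "Q \<in> C" for Q
    using chain that by (auto simp: subset_chain_def)
  have "ideal (\<Inter>C) R"
    using ring.i_Intersect[OF \<open>ring R\<close>] nc_SpecD(1)[OF spec] \<open>C \<noteq> {}\<close> by blast
  moreover have "\<Inter>C \<noteq> carrier R"
    using nc_SpecD(2,3)[OF spec] \<open>C \<noteq> {}\<close> by blast
  moreover have "a \<in> \<Inter>C \<or> b \<in> \<Inter>C"
    if ab: "a \<in> carrier R" "b \<in> carrier R"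
      and sub: "{a \<otimes>\<^bsub>R\<^esub> r \<otimes>\<^bsub>R\<^esub> b | r. r \<in> carrier R} \<subseteq> \<Inter>C" for a b
  proof (rule ccontr)
    assume "\<not> (a \<in> \<Inter>C \<or> b \<in> \<Inter>C)"
    then obtain Q Q' where Q: "Q \<in> C" "a \<notin> Q" "Q' \<in> C" "b \<notin> Q'" by blast
    then have "Q \<subseteq> Q' \<or> Q' \<subseteq> Q" using chain by (auto simp: subset_chain_def)
    then obtain Q'' where Q'': "Q'' \<in> C" "a \<notin> Q''" "b \<notin> Q''" using Q by blast
    have "a \<otimes>\<^bsub>R\<^esub> r \<otimes>\<^bsub>R\<^esub> b \<in> Q''" if "r \<in> carrier R" for r
      using sub Q''(1) that by blast
    then show False using nc_SpecD(4)[OF spec[OF Q''(1)] ab] Q'' by blast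
  qed
  ultimately show ?thesis by (simp add: nc_Spec_def nc_prime_ideal_def)
qed

lemma preimage_mono: "Q \<subseteq> Q' \<Longrightarrow> preimage S f Q \<subseteq> preimage S f Q'"
  by (auto simp: preimage_def)

lemma preimage_Inter: "C \<noteq> {} \<Longrightarrow> preimage S f (\<Inter>C) = (\<Inter>Q\<in>C. preimage S f Q)"
  by (auto simp: preimage_def)

text \<open>Membership in \<open>B\<close> is assumed because a prime of \<open>R\<close> may
  contract to all of \<open>carrier S\<close>; for a \<open>D\<close>-chain it follows from
  \<open>D\<close> being a set of primes.\<close>

lemma subset_chain_image_preimage:
  assumes "subset.chain A C" and "preimage S f ` C \<subseteq> B"
  shows "subset.chain B (preimage S f ` C)"
  unfolding subset_chain_def
proof (intro conjI ballI)
  fix I J assume "I \<in> preimage S f ` C" "J \<in> preimage S f ` C"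
  then obtain Q Q' where Q: "Q \<in> C" "Q' \<in> C" "I = preimage S f Q" "J = preimage S f Q'" by blast
  then have "Q \<subseteq> Q' \<or> Q' \<subseteq> Q" using assms(1) by (auto simp: subset_chain_def)
  then show "I \<subseteq> J \<or> J \<subseteq> I"
    unfolding Q(3,4) by (metis preimage_mono)
qed (rule assms(2))

text \<open>Turns the condition on contractions into membership in one fixed family, so that general
  facts on chains and maximal chains of sets apply.\<close>

lemma D_chain_iff: "D_chain S R f D C \<longleftrightarrow> subset.chain {Q \<in> nc_Spec R. preimage S f Q \<in> D} C"
  by (auto simp: D_chain_def subset_chain_def)

lemma D_chain_insert_below:
  assumes "D_chain S R f D C" "Q \<in> nc_Spec R" "preimage S f Q \<in> D" "\<And>Q'. Q' \<in> C \<Longrightarrow> Q \<subseteq> Q'"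
  shows "D_chain S R f D (insert Q C)"
  using assms by (auto simp: D_chain_iff subset_chain_insert)

text \<open>The maximal chain is obtained from Hausdorff's principle applied to the members of \<open>A\<close>
  comparable to all of \<open>C\<close>, so that it is forced to contain \<open>C\<close>.\<close>

lemma subset_chain_extend_maxchain:
  assumes C: "subset.chain A C"
  obtains M where "C \<subseteq> M" "subset.maxchain A M"
proof -
  define B where "B = {X \<in> A. \<forall>Y \<in> C. X \<subseteq> Y \<or> Y \<subseteq> X}"
  obtain M where M: "subset.maxchain B M" using subset.Hausdorff by blast
  then have chain_M: "subset.chain B M" and max_M: "\<And>N. subset.chain B N \<Longrightarrow> \<not> M \<subset> N"
    by (auto simp: subset.maxchain_def)
  have cmp_M: "X \<subseteq> Y \<or> Y \<subseteq> X" if "X \<in> M" "Y \<in> M" for X Y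
    using chain_M that by (simp add: subset_chain_def)
  have cmp_C: "X \<subseteq> Y \<or> Y \<subseteq> X" if "X \<in> C" "Y \<in> C" for X Y
    using C that by (simp add: subset_chain_def)
  have C_B: "C \<subseteq> B" using C cmp_C unfolding B_def subset_chain_def by simp blast
  have M_B: "M \<subseteq> B" using chain_M by (simp add: subset_chain_def)
  then have cmp_MC: "X \<subseteq> Y \<or> Y \<subseteq> X" if "X \<in> M" "Y \<in> C" for X Y
    using that unfolding B_def by blast
  have "subset.chain B (M \<union> C)"
    unfolding subset_chain_def
  proof (intro conjI ballI)
    show "M \<union> C \<subseteq> B" using M_B C_B by simp
    fix X Y assume "X \<in> M \<union> C" "Y \<in> M \<union> C"
    then show "X \<subseteq> Y \<or> Y \<subseteq> X"
      using cmp_M[of X Y] cmp_C[of X Y] cmp_MC[of X Y] cmp_MC[of Y X]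
      by (elim UnE) (simp_all add: disj_commute)
  qed
  then have "C \<subseteq> M" using max_M by blast
  moreover have "subset.maxchain A M"
    unfolding subset.maxchain_def
  proof (intro conjI notI)
    show "subset.chain A M" using chain_M by (auto simp: B_def subset_chain_def)
    assume "\<exists>N. subset.chain A N \<and> M \<subset> N"
    \<comment> \<open>Since \<open>N\<close> is a chain containing \<open>C\<close>, its members are
      comparable to all of \<open>C\<close>; hence \<open>N\<close> lies in \<open>B\<close>, where
      \<open>M\<close> is already maximal.\<close>
    then obtain N where N: "subset.chain A N" "M \<subset> N" by blast
    with \<open>C \<subseteq> M\<close> have "subset.chain B N" unfolding B_def subset_chain_def by blast
    with max_M N(2) show False by blast
  qed
  ultimately show ?thesis by (rule that)
qed

lemma maximal_D_chain_iff:
  "maximal_D_chain S R f D C \<longleftrightarrow> subset.maxchain {Q \<in> nc_Spec R. preimage S f Q \<in> D} C"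
  by (simp add: maximal_D_chain_def subset.maxchain_def D_chain_iff)

theorem proposition2p5:
  fixes S :: "('a, 'm) ring_scheme" and R :: "('b, 'n) ring_scheme" and f :: "'a \<Rightarrow> 'b"
  assumes "ring S" and "\<one>\<^bsub>S\<^esub> \<noteq> \<zero>\<^bsub>S\<^esub>"
    and "ring R" and "\<one>\<^bsub>R\<^esub> \<noteq> \<zero>\<^bsub>R\<^esub>"
    and "f \<in> rng_hom S R"
    and "f ` carrier S \<subseteq> ring_center R"
  shows "GD S R f \<longleftrightarrow>
    (\<forall>D. subset.chain (nc_Spec S) D \<and> D \<noteq> {} \<longrightarrow>
      (\<forall>C. maximal_D_chain S R f D C \<and> C \<noteq> {} \<longrightarrow>
        (\<forall>P \<in> D. \<exists>Q \<in> C. preimage S f Q \<subseteq> P)))"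
proof (intro iffI allI impI ballI)
  fix D C P
  assume gd: "GD S R f" and D: "subset.chain (nc_Spec S) D \<and> D \<noteq> {}"
    and C: "maximal_D_chain S R f D C \<and> C \<noteq> {}" and P: "P \<in> D"
  have DC: "D_chain S R f D C" and max: "\<And>C'. D_chain S R f D C' \<Longrightarrow> \<not> C \<subset> C'"
    and ne: "C \<noteq> {}"
    using C by (auto simp: maximal_D_chain_def)
  have chain_C: "subset.chain (nc_Spec R) C" and pre_D: "preimage S f ` C \<subseteq> D"
    using DC by (auto simp: D_chain_def)
  have D_spec: "D \<subseteq> nc_Spec S" using D by (auto simp: subset_chain_def)
  show "\<exists>Q \<in> C. preimage S f Q \<subseteq> P"
  proof (rule ccontr)
    assume no: "\<not> (\<exists>Q \<in> C. preimage S f Q \<subseteq> P)"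
    have above: "P \<subseteq> preimage S f Q" if "Q \<in> C" for Q
    proof -
      have "preimage S f Q \<subseteq> P \<or> P \<subseteq> preimage S f Q"
        using D pre_D P that unfolding subset_chain_def by blast
      then show ?thesis using no that by blast
    qed
    have Int_spec: "\<Inter>C \<in> nc_Spec R"
      using nc_Spec_Inter_chain[OF \<open>ring R\<close> chain_C ne] .
    \<comment> \<open>Contraction commutes with intersection, so the contraction of
      \<open>\<Inter>C\<close> is the intersection of a chain of primes of \<open>S\<close>, hence
      prime.\<close>
    have "subset.chain (nc_Spec S) (preimage S f ` C)"
      using subset_chain_image_preimage[OF chain_C] pre_D D_spec by blast
    then have pre_spec: "preimage S f (\<Inter>C) \<in> nc_Spec S"
      using nc_Spec_Inter_chain[OF \<open>ring S\<close>] ne by (simp add: preimage_Inter)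
    have P_le: "P \<subseteq> preimage S f (\<Inter>C)"
      using above by (auto simp: preimage_Inter[OF ne])
    obtain Q where Q: "Q \<in> nc_Spec R" "Q \<subseteq> \<Inter>C" "preimage S f Q = P"
    \<comment> \<open>\<open>GD\<close> speaks only of proper inclusions, so in the case of equality
      \<open>\<Inter>C\<close> itself serves as \<open>Q\<close>.\<close>
    proof (cases "P = preimage S f (\<Inter>C)")
      case True
      with Int_spec that show ?thesis by blast
    next
      case False
      then have "P \<subset> preimage S f (\<Inter>C)" using P_le by blast
      then have "\<exists>Q \<in> nc_Spec R. Q \<subset> \<Inter>C \<and> lies_over S f Q P"
        using gd P D_spec pre_spec Int_spec unfolding GD_def lies_over_def by blast
      then show ?thesis using that by (auto simp: lies_over_def)
    qed
    have "D_chain S R f D (insert Q C)"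
      using D_chain_insert_below[OF DC Q(1)] Q P by blast
    \<comment> \<open>Maximality forces the adjoined \<open>Q\<close> to be in \<open>C\<close>
      already, although no member of \<open>C\<close> contracts into \<open>P\<close>.\<close>
    then have "Q \<in> C" using max by blast
    then show False using no Q(3) by blast
  qed
next
  assume *: "\<forall>D. subset.chain (nc_Spec S) D \<and> D \<noteq> {} \<longrightarrow>
      (\<forall>C. maximal_D_chain S R f D C \<and> C \<noteq> {} \<longrightarrow>
        (\<forall>P \<in> D. \<exists>Q \<in> C. preimage S f Q \<subseteq> P))"
  show "GD S R f"
    unfolding GD_def
  proof (intro ballI impI)
    fix P1 P2 Q2
    assume P: "P1 \<in> nc_Spec S" "P2 \<in> nc_Spec S" "P1 \<subset> P2"
      and Q2: "Q2 \<in> nc_Spec R" "lies_over S f Q2 P2"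
    \<comment> \<open>\<open>P2\<close> makes \<open>{Q2}\<close> a chain for \<open>?D\<close>; the
      hypothesis, applied to \<open>P1\<close>, then supplies the prime below
      \<open>Q2\<close>.\<close>
    let ?D = "{P1, P2}"
    have "subset.chain {Q \<in> nc_Spec R. preimage S f Q \<in> ?D} {Q2}"
      using Q2 by (auto simp: subset_chain_def lies_over_def)
    then obtain C where C: "{Q2} \<subseteq> C" "maximal_D_chain S R f ?D C"
      unfolding maximal_D_chain_iff by (rule subset_chain_extend_maxchain)
    have "subset.chain (nc_Spec S) ?D" using P by (auto simp: subset_chain_def)
    then have "\<forall>P \<in> ?D. \<exists>Q \<in> C. preimage S f Q \<subseteq> P"
      using *[rule_format, of ?D C] C by blast
    then obtain Q where Q: "Q \<in> C" "preimage S f Q \<subseteq> P1" by blast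
    have DC: "D_chain S R f ?D C" using C(2) by (simp add: maximal_D_chain_def)
    then have Q_spec: "Q \<in> nc_Spec R" and "preimage S f Q \<in> ?D" and cmp: "Q \<subseteq> Q2 \<or> Q2 \<subseteq> Q"
      using Q C(1) by (auto simp: D_chain_def subset_chain_def)
    \<comment> \<open>The contraction of \<open>Q\<close> is \<open>P1\<close> or \<open>P2\<close>,
      and \<open>P2\<close> is not contained in \<open>P1\<close>.\<close>
    then have over: "preimage S f Q = P1" using Q(2) P(3) by blast
    \<comment> \<open>Contracting \<open>Q2 \<subseteq> Q\<close> would give
      \<open>P2 \<subseteq> P1\<close>.\<close>
    have "\<not> Q2 \<subseteq> Q"
      using preimage_mono[of Q2 Q S f] over Q2(2) P(3) by (auto simp: lies_over_def)
    then have "Q \<subset> Q2" using cmp by blast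
    then show "\<exists>Q1 \<in> nc_Spec R. Q1 \<subset> Q2 \<and> lies_over S f Q1 P1"
      using Q_spec over by (auto simp: lies_over_def)
  qed
qed

end
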